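(* Every finite simple planar graph $G$ of girth at least $6$ satisfies $\operatorname{diam}(I(G))\le 4$.
   Context: All graphs are finite, simple and undirected. The girth of a graph is the length of a shortest cycle (infinite if the graph is acyclic). An orientation of $G$ assigns a direction to each edge of $G$. Given an orientation $\vec G$ of $G$ and a set $X\subseteq V(G)$, the inversion of $X$ is the operation that reverses the orientation of every arc with both endpoints in $X$. The inversion graph $I(G)$ has as its vertices the labeled orientations of $G$, two orientations being adjacent when one is obtained from the other by a single inversion. The inversion diameter $\operatorname{diam}(I(G))$ is the diameter of $I(G)$, i.e. the largest, over all pairs of orientations of $G$, of the minimum number of inversions transforming one into the other. *)

theory Defs
  imports
    "HOL-Analysis.Analysis"
    "HOL-Library.Extended_Nat"
    "Graph_Theory.Pair_Digraph"
    "Graph_Theory.Shortest_Path"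
begin

text \<open>
  A finite simple undirected graph is a \<^const>\<open>pair_graph\<close>: a finite, symmetric, loop-free digraph
  without parallel arcs. The undirected edge \<open>uv\<close> is the pair of arcs \<open>(u, v)\<close>, \<open>(v, u)\<close>.
\<close>

text \<open>
  In a symmetric digraph an edge traversed back and forth is a \<^const>\<open>pre_digraph.cycle\<close> of length 2;
  the cycles of the undirected graph are those of length at least 3.
  The infimum of the empty set is \<open>\<infinity>\<close>.
\<close>

definition girth :: "'a pair_pre_digraph \<Rightarrow> enat" where
  "girth G = (INF p \<in> {p. pre_digraph.cycle (with_proj G) p \<and> 3 \<le> length p}. enat (length p))"

text \<open>The constant weight 1 turns the library's shortest-path weight into the graph distance.\<close>

definition graph_dist :: "'a pair_pre_digraph \<Rightarrow> 'a \<Rightarrow> 'a \<Rightarrow> ereal" where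
  "graph_dist G u v = wf_digraph.\<mu> (with_proj G) (\<lambda>_. 1) u v"

definition graph_diameter :: "'a pair_pre_digraph \<Rightarrow> ereal" where
  "graph_diameter G = (SUP u \<in> pverts G. SUP v \<in> pverts G. graph_dist G u v)"

text \<open>
  A drawing in the plane: \<open>pos\<close> places the vertices at distinct points, and \<open>\<gamma> {u, v}\<close> is the
  Jordan arc representing the edge \<open>uv\<close>, indexed by the unordered pair of its ends.
  The last two conditions together say that two distinct arcs meet only in a common end,
  and that an arc passes through no vertex except its ends.
\<close>

definition plane_drawing ::
  "'a pair_pre_digraph \<Rightarrow> ('a \<Rightarrow> complex) \<Rightarrow> ('a set \<Rightarrow> real \<Rightarrow> complex) \<Rightarrow> bool" where
  "plane_drawing G pos \<gamma> \<longleftrightarrow>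
     inj_on pos (pverts G) \<and>
     (\<forall>(u, v) \<in> parcs G.
        arc (\<gamma> {u, v}) \<and>
        {pathstart (\<gamma> {u, v}), pathfinish (\<gamma> {u, v})} = {pos u, pos v} \<and>
        path_image (\<gamma> {u, v}) \<inter> pos ` pverts G = {pos u, pos v}) \<and>
     (\<forall>(u, v) \<in> parcs G. \<forall>(x, y) \<in> parcs G.
        {u, v} \<noteq> {x, y} \<longrightarrow>
        path_image (\<gamma> {u, v}) \<inter> path_image (\<gamma> {x, y}) \<subseteq> pos ` pverts G)"

definition planar :: "'a pair_pre_digraph \<Rightarrow> bool" where
  "planar G \<longleftrightarrow> (\<exists>pos \<gamma>. plane_drawing G pos \<gamma>)"

text \<open>An orientation keeps exactly one of the two arcs \<open>(u, v)\<close>, \<open>(v, u)\<close> of every edge.\<close>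

definition orientations :: "'a pair_pre_digraph \<Rightarrow> 'a rel set" where
  "orientations G =
     {D. D \<subseteq> parcs G \<and> (\<forall>(u, v) \<in> parcs G. ((u, v) \<in> D) \<noteq> ((v, u) \<in> D))}"

definition inversion :: "'a set \<Rightarrow> 'a rel \<Rightarrow> 'a rel" where
  "inversion X D = (\<lambda>(u, v). if u \<in> X \<and> v \<in> X then (v, u) else (u, v)) ` D"

text \<open>
  An inversion that reverses no arc would give a loop; the condition \<open>D \<noteq> D'\<close> keeps the
  inversion graph simple and does not affect distances.
\<close>

definition inversion_graph :: "'a pair_pre_digraph \<Rightarrow> 'a rel pair_pre_digraph" where
  "inversion_graph G =
     \<lparr> pverts = orientations G,
       parcs = {(D, D'). D \<in> orientations G \<and> D' \<in> orientations G \<and> D \<noteq> D' \<and>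
                         (\<exists>X \<subseteq> pverts G. D' = inversion X D)} \<rparr>"

lemma in_inversion_iff:
  "(u, v) \<in> inversion X D \<longleftrightarrow> (if u \<in> X \<and> v \<in> X then (v, u) \<in> D else (u, v) \<in> D)"
  unfolding inversion_def image_iff Bex_def split_paired_Ex by auto

lemma inversion_inversion: "inversion X (inversion X D) = D"
  by (rule set_eqI) (auto simp: in_inversion_iff split: if_splits)

lemma inversion_in_orientations:
  assumes "pair_graph G" "D \<in> orientations G"
  shows "inversion X D \<in> orientations G"
proof -
  have "symmetric (with_proj G)"
    using assms(1) unfolding pair_graph_def pair_pseudo_graph_def
    by (simp add: pair_sym_digraph.pair_sym_arcs)
  then have "(v, u) \<in> parcs G" if "(u, v) \<in> parcs G" for u v
    using that by (simp add: symmetric_def sym_def)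
  then show ?thesis
    using assms(2) unfolding orientations_def
    by (auto simp: in_inversion_iff subset_iff split: if_splits)
qed

lemma pair_graph_inversion_graph:
  assumes "pair_graph G"
  shows "pair_graph (inversion_graph G)"
proof -
  interpret pair_graph G by fact
  have fin: "finite (orientations G)"
    by (rule finite_subset[of _ "Pow (parcs G)"]) (auto simp: orientations_def)
  have "finite (parcs (inversion_graph G))"
    by (rule finite_subset[of _ "orientations G \<times> orientations G"])
       (auto simp: inversion_graph_def fin)
  moreover have "symmetric (with_proj (inversion_graph G))"
    unfolding symmetric_def
    by (auto simp: inversion_graph_def sym_def inversion_inversion)
  ultimately show ?thesis
    by unfold_locales (auto simp: inversion_graph_def fin)
qed

end

theory Submission
  imports Defs
begin

text \<open>
  Invert sets \<open>X\<^sub>0, \<dots>, X\<^sub>3\<close> one after the other. An edge \<open>uv\<close> ends up reversed iff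
  the number of \<open>i\<close> with \<open>u, v \<in> X\<^sub>i\<close> is odd, that is, iff the vectors
  \<open>x u, x v\<close> over the field with two elements that record which of the four sets contain \<open>u\<close>
  and \<open>v\<close> have scalar product 1. So four inversions lead from any orientation to any other one as
  soon as every 0/1-labelling of the edges is the scalar product of some family of vectors of
  length 4 (\<open>graph_dist_orientations\<close>).

  Such a family is built vertex by vertex. If the neighbours of \<open>v\<close> that are already treated carry
  linearly independent vectors, then the equations for \<open>x v\<close> are solvable, and two vectors are
  independent as soon as they are nonzero and distinct. So all vectors are kept nonzero, and a vertex
  with only two neighbours \<open>a, b\<close> may be deleted at the price of a new constraint \<open>x a \<noteq> x b\<close>.
  Give the original edges weight 1 and the new constraints weight 1/2. If every nonempty vertex set
  \<open>W\<close> spans weight less than \<open>3/2 |W|\<close>, this stays true after such a deletion, which trades weight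
  2 for weight 1/2; and averaging gives a vertex with \<open>p\<close> edges and \<open>q\<close> constraints where
  \<open>p + q/2 < 3\<close>. Then \<open>p \<le> 2\<close>, and the equations have more solutions than the \<open>q + 1\<close> values
  that are excluded, namely zero and the vectors at the other ends of the constraints
  (\<open>vectors_with_prescribed_products\<close>).

  It remains to see that a planar graph of girth at least 6 has fewer than \<open>3/2 n\<close> edges; all its
  induced subgraphs are of the same kind. This follows by counting edges around faces
  (\<open>card_edges_less\<close>): a graph with at least two faces has at least six edges around each face
  and at most two faces along each edge, while Euler's inequality bounds the number of faces from
  below. As the edges are arbitrary Jordan arcs, the topology is drawn from two theorems of the plane.
  If adding an edge \<open>e\<close> to a drawing \<open>K\<close> closes a cycle \<open>C\<close>, then \<open>C \<inter> K\<close> is an arc, and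
  Janiszewski's theorem says that two points of one face of \<open>K\<close> are separated by \<open>e\<close> only if \<open>C\<close>
  separates them; by the Jordan curve theorem \<open>C\<close> has two sides, and both occur next to \<open>e\<close>. So the
  face containing \<open>e\<close> splits into exactly two. If \<open>e\<close> joins two parts of \<open>K\<close>, then each part
  meets \<open>e\<close> in one point, and Janiszewski's theorem shows that no face splits.
\<close>


section \<open>Counting solutions of linear equations over the field with two elements\<close>

text \<open>A subset of a finite set of coordinates stands for a 0/1-vector. Then symmetric difference is
  addition, and the parity of \<open>card (x \<inter> y)\<close> is the scalar product, which is linear.\<close>
lemma odd_card_sym_diff_Int:
  assumes "finite a"
  shows "odd (card (((y - t) \<union> (t - y)) \<inter> a)) \<longleftrightarrow> odd (card (y \<inter> a)) \<noteq> odd (card (t \<inter> a))"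
proof -
  define A B where "A = y \<inter> a" and "B = t \<inter> a"
  have fin: "finite A" "finite B" using assms by (simp_all add: A_def B_def)
  have "card A = card (A \<inter> B) + card (A - B)" by (rule card_Int_Diff[OF fin(1)])
  moreover have "card B = card (A \<inter> B) + card (B - A)"
    using card_Int_Diff[OF fin(2), of A] by (simp only: Int_commute)
  moreover have "card ((A - B) \<union> (B - A)) = card (A - B) + card (B - A)"
    using fin by (intro card_Un_disjoint) auto
  moreover have "((y - t) \<union> (t - y)) \<inter> a = (A - B) \<union> (B - A)" unfolding A_def B_def by blast
  ultimately show ?thesis unfolding A_def[symmetric] B_def[symmetric] by auto
qed

text \<open>Translation by \<open>t\<close> changes the product with \<open>a\<close>, so it exchanges the solutions in \<open>S\<close> of the
  two equations with left-hand side \<open>a\<close>.\<close>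
lemma card_half:
  fixes S :: "'i set set"
  assumes "finite S" and a: "finite a"
    and closed: "\<And>y. y \<in> S \<Longrightarrow> (y - t) \<union> (t - y) \<in> S"
    and t: "odd (card (t \<inter> a))"
  shows "card S = 2 * card {y \<in> S. odd (card (y \<inter> a)) = \<alpha>}"
proof -
  let ?A = "\<lambda>\<alpha>. {y \<in> S. odd (card (y \<inter> a)) = \<alpha>}"
  let ?f = "\<lambda>y. (y - t) \<union> (t - y)"
  have flip: "odd (card (?f y \<inter> a)) \<longleftrightarrow> \<not> odd (card (y \<inter> a))" for y
    using odd_card_sym_diff_Int[OF a, of y t] t by simp
  have ff: "?f (?f y) = y" for y by blast
  have "bij_betw ?f (?A \<alpha>) (?A (\<not> \<alpha>))"
    by (rule bij_betw_byWitness[where f' = ?f]) (use ff closed flip in auto)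
  then have "card (?A \<alpha>) = card (?A (\<not> \<alpha>))" by (rule bij_betw_same_card)
  moreover have "S = ?A \<alpha> \<union> ?A (\<not> \<alpha>)" by auto
  then have "card S = card (?A \<alpha> \<union> ?A (\<not> \<alpha>))" by (rule arg_cong)
  moreover have "\<dots> = card (?A \<alpha>) + card (?A (\<not> \<alpha>))"
    using assms(1) by (intro card_Un_disjoint) auto
  ultimately show ?thesis by simp
qed

lemma card_solutions_1:
  assumes "finite D" "a \<subseteq> D" "a \<noteq> {}"
  shows "2 ^ card D = 2 * card {y \<in> Pow D. odd (card (y \<inter> a)) = \<alpha>}"
proof -
  obtain i where "i \<in> a" using assms(3) by blast
  then have "card (Pow D) = 2 * card {y \<in> Pow D. odd (card (y \<inter> a)) = \<alpha>}"
    using assms by (intro card_half[where t = "{i}"]) (auto intro: finite_subset)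
  then show ?thesis using assms(1) by (simp add: card_Pow)
qed

text \<open>The solutions of the first equation are invariant under translation by any \<open>t\<close> orthogonal to
  \<open>a\<close>. Since \<open>b\<close> is neither zero nor \<open>a\<close>, such a \<open>t\<close> exists with product 1 with \<open>b\<close>, and it
  exchanges the solutions of the two possible second equations.\<close>
lemma card_solutions_2:
  assumes "finite D" "a \<subseteq> D" "a \<noteq> {}" "b \<subseteq> D" "b \<noteq> {}" "a \<noteq> b"
  shows "2 ^ card D =
    4 * card {y \<in> Pow D. odd (card (y \<inter> a)) = \<alpha> \<and> odd (card (y \<inter> b)) = \<beta>}"
proof -
  have fin: "finite a" "finite b" using assms finite_subset by metis+
  obtain t where t: "t \<subseteq> D" "\<not> odd (card (t \<inter> a))" "odd (card (t \<inter> b))"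
  proof (cases "b \<subseteq> a")
    case True
    then obtain i j where "i \<in> b" "j \<in> a" "j \<notin> b" "i \<in> a" "i \<noteq> j" using assms by blast
    then show thesis using that[of "{i, j}"] assms by (auto simp: Int_insert_left)
  next
    case False
    then obtain i where "i \<in> b" "i \<notin> a" by blast
    then show thesis using that[of "{i}"] assms by auto
  qed
  let ?S = "{y \<in> Pow D. odd (card (y \<inter> a)) = \<alpha>}"
  have "card ?S = 2 * card {y \<in> ?S. odd (card (y \<inter> b)) = \<beta>}"
  proof (rule card_half[where t = t])
    fix y assume y: "y \<in> ?S"
    have "odd (card (((y - t) \<union> (t - y)) \<inter> a)) = odd (card (y \<inter> a))"
      using odd_card_sym_diff_Int[OF fin(1), of y t] t(2) by simp
    then show "(y - t) \<union> (t - y) \<in> ?S" using y t(1) by auto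
  qed (use assms(1) fin t in auto)
  moreover have "{y \<in> ?S. odd (card (y \<inter> b)) = \<beta>} =
    {y \<in> Pow D. odd (card (y \<inter> a)) = \<alpha> \<and> odd (card (y \<inter> b)) = \<beta>}" by auto
  ultimately show ?thesis using card_solutions_1[OF assms(1-3), of \<alpha>] by simp
qed

text \<open>Two distinct nonzero vectors are linearly independent. This fails from three equations on: three
  pairwise distinct nonzero vectors may sum up to zero.\<close>
lemma card_solutions:
  assumes "finite D" "finite N" "card N \<le> 2" "inj_on x N"
    and "\<And>w. w \<in> N \<Longrightarrow> x w \<subseteq> D \<and> x w \<noteq> {}"
  shows "2 ^ card D = 2 ^ card N * card {y \<in> Pow D. \<forall>w\<in>N. odd (card (y \<inter> x w)) = \<pi> w}"
proof -
  consider "card N = 0" | "card N = 1" | "card N = 2" using assms(3) by linarith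
  then show ?thesis
  proof cases
    case 1
    then show ?thesis using assms(1,2) by (simp add: card_Pow flip: Pow_def)
  next
    case 2
    then obtain w where "N = {w}" using card_1_singletonE by blast
    then show ?thesis using card_solutions_1[of D "x w" "\<pi> w"] assms by simp
  next
    case 3
    then obtain w z where wz: "N = {w, z}" "w \<noteq> z" by (auto simp: card_2_iff)
    then have "x w \<noteq> x z" using assms(4) by auto
    then show ?thesis
      using card_solutions_2[of D "x w" "x z" "\<pi> w" "\<pi> z"] assms(1,5) wz by (simp add: conj_assoc)
  qed
qed

section \<open>Vectors with prescribed products on the edges of a sparse graph\<close>

definition edges_at :: "'a set set \<Rightarrow> 'a \<Rightarrow> 'a set set" where
  "edges_at P v = {e \<in> P. v \<in> e}"

definition nbrs :: "'a set set \<Rightarrow> 'a \<Rightarrow> 'a set" where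
  "nbrs P v = {w. {v, w} \<in> P}"

lemma edges_at_eq:
  assumes "\<forall>e\<in>P. card e = 2"
  shows "edges_at P v = (\<lambda>w. {v, w}) ` nbrs P v"
proof (intro equalityI subsetI)
  fix e assume "e \<in> edges_at P v"
  then have "e \<in> P" "v \<in> e" "card e = 2" using assms by (auto simp: edges_at_def)
  then obtain w where "e = {v, w}" by (auto simp: card_2_iff)
  then show "e \<in> (\<lambda>w. {v, w}) ` nbrs P v" using \<open>e \<in> P\<close> by (auto simp: nbrs_def)
qed (auto simp: edges_at_def nbrs_def)

lemma card_edges_at:
  assumes "\<forall>e\<in>P. card e = 2"
  shows "card (edges_at P v) = card (nbrs P v)"
  unfolding edges_at_eq[OF assms]
  by (rule card_image) (auto simp: inj_on_def doubleton_eq_iff)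

lemma sum_card_edges_at:
  assumes "finite V" and P: "\<forall>e\<in>P. e \<subseteq> V \<and> card e = 2"
  shows "(\<Sum>v\<in>V. card (edges_at P v)) = 2 * card P"
proof -
  have "finite P" using assms by (intro finite_subset[of P "Pow V"]) auto
  moreover have "\<forall>e\<in>P. card {v \<in> V. v \<in> e} = 2"
  proof
    fix e assume "e \<in> P"
    then have "{v \<in> V. v \<in> e} = e" "card e = 2" using P by auto
    then show "card {v \<in> V. v \<in> e} = 2" by simp
  qed
  ultimately show ?thesis
    unfolding edges_at_def using sum_multicount[of V P "\<lambda>v e. v \<in> e" 2] assms(1) by simp
qed

text \<open>Otherwise the weighted degrees would sum up to at least \<open>6 |V|\<close>, but by the handshake lemma they
  sum up to twice the total weight.\<close>
lemma low_degree_vertex: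
  assumes "finite V" "V \<noteq> {}" "\<forall>e\<in>P. e \<subseteq> V \<and> card e = 2" "\<forall>e\<in>Q. e \<subseteq> V \<and> card e = 2"
    and "2 * card P + card Q < 3 * card V"
  obtains v where "v \<in> V" "2 * card (nbrs P v) + card (nbrs Q v) \<le> 5"
proof (rule ccontr)
  assume neg: "\<not> thesis"
  have "6 * card V = (\<Sum>v\<in>V. 6)" by simp
  also have "\<dots> \<le> (\<Sum>v\<in>V. 2 * card (edges_at P v) + card (edges_at Q v))"
  proof (rule sum_mono)
    fix v assume "v \<in> V"
    then have "\<not> 2 * card (nbrs P v) + card (nbrs Q v) \<le> 5" using neg that by blast
    then show "6 \<le> 2 * card (edges_at P v) + card (edges_at Q v)"
      using card_edges_at[of P v] card_edges_at[of Q v] assms(3,4) by auto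
  qed
  also have "\<dots> = 2 * (2 * card P + card Q)"
    using sum_card_edges_at[OF assms(1,3)] sum_card_edges_at[OF assms(1,4)]
    by (simp add: sum.distrib flip: sum_distrib_left)
  finally have "6 * card V \<le> 2 * (2 * card P + card Q)" .
  then show False using assms(5) by simp
qed

text \<open>\<open>P\<close> are the edges whose products are prescribed, \<open>Q\<close> the pairs that must receive distinct
  vectors. Constraints arise only in the induction on \<open>V\<close>, from deleted vertices with two
  neighbours, so the case of interest is \<open>Q = {}\<close>; they count half as much as edges, because such a
  deletion takes away weight 2 but lowers the bound \<open>3/2 |W|\<close> by 3/2 only, which leaves room for 1/2.\<close>
lemma vectors_with_prescribed_products:
  fixes V :: "'a set" and P Q :: "'a set set" and \<pi> :: "'a set \<Rightarrow> bool"
  assumes "finite V"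
    and "\<forall>e\<in>P. e \<subseteq> V \<and> card e = 2" and "\<forall>e\<in>Q. e \<subseteq> V \<and> card e = 2"
    and "\<forall>W. W \<subseteq> V \<longrightarrow> W \<noteq> {} \<longrightarrow>
      2 * card {e \<in> P. e \<subseteq> W} + card {e \<in> Q. e \<subseteq> W} < 3 * card W"
  shows "\<exists>x :: 'a \<Rightarrow> nat set. (\<forall>v\<in>V. x v \<subseteq> {..<4} \<and> x v \<noteq> {}) \<and>
    (\<forall>u v. {u, v} \<in> P \<longrightarrow> odd (card (x u \<inter> x v)) = \<pi> {u, v}) \<and>
    (\<forall>u v. {u, v} \<in> Q \<longrightarrow> x u \<noteq> x v)"
  using assms
proof (induction V arbitrary: P Q rule: finite_psubset_induct)
  case (psubset V)
  note fin = psubset.hyps and P = psubset.prems(1) and Q = psubset.prems(2) and sparse = psubset.prems(3)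
  show ?case
  proof (cases "V = {}")
    case True
    then have "P = {}" "Q = {}" using P Q by fastforce+
    then show ?thesis using True by simp
  next
    case False
    have "{e \<in> P. e \<subseteq> V} = P" "{e \<in> Q. e \<subseteq> V} = Q" using P Q by auto
    then have "2 * card P + card Q < 3 * card V" using sparse[rule_format, of V] False by simp
    then obtain v where v: "v \<in> V" "2 * card (nbrs P v) + card (nbrs Q v) \<le> 5"
      using low_degree_vertex[OF fin False P Q] by metis
    let ?N = "nbrs P v" and ?R = "nbrs Q v"
    have N_sub: "?N \<subseteq> V - {v}" "?R \<subseteq> V - {v}" using P Q by (force simp: nbrs_def)+
    have fN: "finite ?N" "finite ?R" using N_sub fin by (meson finite_Diff finite_subset)+
    define P' where "P' = {e \<in> P. v \<notin> e}"
    \<comment> \<open>the two neighbours of a deleted vertex form the new constraint\<close>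
    define Q' where "Q' = {e \<in> Q. v \<notin> e} \<union> (if card ?N = 2 then {?N} else {})"
    have fPQ: "finite P" "finite Q" using P Q fin
      by (auto intro!: finite_subset[of P "Pow V"] finite_subset[of Q "Pow V"])
    have "\<exists>x :: 'a \<Rightarrow> nat set. (\<forall>u\<in>V - {v}. x u \<subseteq> {..<4} \<and> x u \<noteq> {}) \<and>
      (\<forall>u w. {u, w} \<in> P' \<longrightarrow> odd (card (x u \<inter> x w)) = \<pi> {u, w}) \<and>
      (\<forall>u w. {u, w} \<in> Q' \<longrightarrow> x u \<noteq> x w)"
    proof (rule psubset.IH)
      show "V - {v} \<subset> V" using v by blast
      show "\<forall>e\<in>P'. e \<subseteq> V - {v} \<and> card e = 2" using P by (auto simp: P'_def)
      show "\<forall>e\<in>Q'. e \<subseteq> V - {v} \<and> card e = 2" using Q N_sub by (auto simp: Q'_def)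
      show "\<forall>W. W \<subseteq> V - {v} \<longrightarrow> W \<noteq> {} \<longrightarrow>
        2 * card {e \<in> P'. e \<subseteq> W} + card {e \<in> Q'. e \<subseteq> W} < 3 * card W"
      proof (intro allI impI)
        fix W assume W: "W \<subseteq> V - {v}" "W \<noteq> {}"
        let ?P = "{e \<in> P. e \<subseteq> W}" and ?Q = "{e \<in> Q. e \<subseteq> W}"
        have P'W: "{e \<in> P'. e \<subseteq> W} = ?P" using W by (auto simp: P'_def)
        show "2 * card {e \<in> P'. e \<subseteq> W} + card {e \<in> Q'. e \<subseteq> W} < 3 * card W"
        proof (cases "card ?N = 2 \<and> ?N \<subseteq> W")
          case False
          then have "{e \<in> Q'. e \<subseteq> W} = ?Q" using W by (auto simp: Q'_def)
          then show ?thesis using sparse[rule_format, of W] W P'W by auto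
        next
          case True
          \<comment> \<open>compare with \<open>W \<union> {v}\<close>: its budget (doubled, as all weights here) is larger by 3; it contains two
            more edges, which weigh 4, but lacks the new constraint, which weighs 1\<close>
          let ?W = "insert v W"
          have "{e \<in> Q'. e \<subseteq> W} \<subseteq> insert ?N ?Q" by (auto simp: Q'_def)
          then have "card {e \<in> Q'. e \<subseteq> W} \<le> card (insert ?N ?Q)"
            using fPQ by (intro card_mono) auto
          also have "\<dots> \<le> card ?Q + 1" by (simp add: card_insert_le_m1 card_insert_if)
          finally have 1: "card {e \<in> Q'. e \<subseteq> W} \<le> card ?Q + 1" .
          have 2: "card ?Q \<le> card {e \<in> Q. e \<subseteq> ?W}"
            using fPQ by (intro card_mono) auto
          have eq: "edges_at P v = (\<lambda>w. {v, w}) ` ?N" using P by (intro edges_at_eq) auto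
          have "?P \<union> edges_at P v \<subseteq> {e \<in> P. e \<subseteq> ?W}"
            using True unfolding eq by (auto simp: nbrs_def)
          then have "card (?P \<union> edges_at P v) \<le> card {e \<in> P. e \<subseteq> ?W}"
            using fPQ by (intro card_mono) auto
          moreover have "card (?P \<union> edges_at P v) = card ?P + card (edges_at P v)"
            using fPQ W by (intro card_Un_disjoint) (auto simp: edges_at_def)
          moreover have "card (edges_at P v) = 2" using card_edges_at[of P v] P True by simp
          ultimately have 3: "card ?P + 2 \<le> card {e \<in> P. e \<subseteq> ?W}" by simp
          have "card ?W = card W + 1" using W fin by (simp add: finite_subset[of W V] card_insert_if subset_Diff_insert)
          moreover have "?W \<subseteq> V" using W v by auto
          ultimately have "2 * card {e \<in> P. e \<subseteq> ?W} + card {e \<in> Q. e \<subseteq> ?W} < 3 * card W + 3"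
            using sparse[rule_format, of ?W] by simp
          then show ?thesis using 1 2 3 P'W by simp
        qed
      qed
    qed
    then obtain x :: "'a \<Rightarrow> nat set" where
      x: "\<forall>u\<in>V - {v}. x u \<subseteq> {..<4} \<and> x u \<noteq> {}"
      and xP: "\<forall>u w. {u, w} \<in> P' \<longrightarrow> odd (card (x u \<inter> x w)) = \<pi> {u, w}"
      and xQ: "\<forall>u w. {u, w} \<in> Q' \<longrightarrow> x u \<noteq> x w"
      by (elim exE conjE)
    have "card ?N \<le> 2" using v(2) by linarith
    \<comment> \<open>this is what the constraint between the two neighbours is for\<close>
    have "inj_on x ?N"
    proof (rule inj_onI, rule ccontr)
      fix a b assume ab: "a \<in> ?N" "b \<in> ?N" "x a = x b" "a \<noteq> b"
      then have "card {a, b} = card ?N"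
        using \<open>card ?N \<le> 2\<close> card_mono[OF fN(1), of "{a, b}"] by simp
      then have "{a, b} = ?N" using ab fN(1) by (intro card_subset_eq) auto
      moreover have "card ?N = 2" using \<open>card {a, b} = card ?N\<close> ab(4) by simp
      ultimately have "{a, b} \<in> Q'" by (simp add: Q'_def)
      then show False using xQ[rule_format, of a b] ab(3) by simp
    qed
    let ?S = "{y \<in> Pow {..<4}. \<forall>w\<in>?N. odd (card (y \<inter> x w)) = \<pi> {v, w}}"
    have "2 ^ card {..<4::nat} = 2 ^ card ?N * card ?S"
      by (rule card_solutions) (use fN \<open>card ?N \<le> 2\<close> \<open>inj_on x ?N\<close> bspec[OF x] N_sub in auto)
    moreover have "card ?N = 0 \<and> card ?R \<le> 5 \<or> card ?N = 1 \<and> card ?R \<le> 3 \<or> card ?N = 2 \<and> card ?R \<le> 1"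
      using v(2) by linarith
    \<comment> \<open>the number of solutions is 16, 8 or 4, against at most 6, 4 or 2 excluded vectors\<close>
    ultimately have "card ?R + 1 < card ?S" by auto
    moreover have "card (insert {} (x ` ?R)) \<le> card ?R + 1"
      using card_image_le[OF fN(2), of x] fN(2) by (simp add: card_insert_if)
    ultimately have "card (insert {} (x ` ?R)) < card ?S" by linarith
    then have "\<not> ?S \<subseteq> insert {} (x ` ?R)"
      using card_mono[of "insert {} (x ` ?R)" ?S] fN(2) by auto
    then obtain y where y: "y \<in> ?S" "y \<noteq> {}" "y \<notin> x ` ?R" by blast
    define z where "z = x(v := y)"
    have z: "z v = y" "\<And>u. u \<noteq> v \<Longrightarrow> z u = x u" by (auto simp: z_def)
    have no_loop: "{v, v} \<notin> P" "{v, v} \<notin> Q" using P Q by fastforce+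
    show ?thesis
    proof (intro exI[of _ z] conjI ballI allI impI)
      fix u assume "u \<in> V"
      then show "z u \<subseteq> {..<4}" "z u \<noteq> {}" using x y by (cases "u = v"; simp add: z)+
    next
      fix u w assume uw: "{u, w} \<in> P"
      consider "u = v" "w \<noteq> v" | "w = v" "u \<noteq> v" | "u \<noteq> v" "w \<noteq> v"
        using no_loop uw by fastforce
      then show "odd (card (z u \<inter> z w)) = \<pi> {u, w}"
      proof cases
        case 1
        then show ?thesis using uw y(1) by (simp add: z nbrs_def)
      next
        case 2
        then show ?thesis using uw y(1) by (simp add: z nbrs_def insert_commute Int_commute)
      next
        case 3
        then show ?thesis using uw xP[rule_format, of u w] by (simp add: z P'_def)
      qed
    next
      fix u w assume uw: "{u, w} \<in> Q"
      consider "u = v" "w \<noteq> v" | "w = v" "u \<noteq> v" | "u \<noteq> v" "w \<noteq> v"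
        using no_loop uw by fastforce
      then show "z u \<noteq> z w"
      proof cases
        case 1
        then show ?thesis using uw y(3) by (auto simp: z nbrs_def)
      next
        case 2
        then show ?thesis using uw y(3) by (auto simp: z nbrs_def insert_commute)
      next
        case 3
        then show ?thesis using uw xQ[rule_format, of u w] by (simp add: z Q'_def)
      qed
    qed
  qed
qed

section \<open>Connection through a set of edges\<close>

text \<open>Edges are unordered pairs, so the pairs with \<open>{x, y} \<in> M\<close> form a symmetric relation.\<close>
definition joined :: "'a set set \<Rightarrow> 'a \<Rightarrow> 'a \<Rightarrow> bool" where
  "joined M u v \<longleftrightarrow> (u, v) \<in> {(x, y). {x, y} \<in> M}\<^sup>*"

lemma joined_refl [simp]: "joined M u u"
  by (simp add: joined_def)

lemma joined_sym: "joined M u v \<Longrightarrow> joined M v u"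
proof -
  have "sym {(x, y). {x, y} \<in> M}"
    by (auto simp: sym_def insert_commute)
  then show "joined M u v \<Longrightarrow> joined M v u"
    unfolding joined_def by (meson sym_rtrancl symD)
qed

lemma joined_trans: "joined M u v \<Longrightarrow> joined M v w \<Longrightarrow> joined M u w"
  unfolding joined_def by (rule rtrancl_trans)

lemma joined_edge: "{u, v} \<in> M \<Longrightarrow> joined M u v"
  unfolding joined_def by auto

lemma joined_mono: "M \<subseteq> M' \<Longrightarrow> joined M u v \<Longrightarrow> joined M' u v"
  unfolding joined_def by (rule subsetD[OF rtrancl_mono]) auto

lemma joined_insert_joined:
  assumes "joined M u v"
  shows "joined (insert {u, v} M) = joined M"
proof (intro ext iffI)
  fix x y
  assume "joined (insert {u, v} M) x y"
  then have "(x, y) \<in> {(x, y). {x, y} \<in> insert {u, v} M}\<^sup>*"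
    by (simp add: joined_def)
  then show "joined M x y"
  proof (induction rule: rtrancl_induct)
    case base
    then show ?case by simp
  next
    case (step y z)
    then have "{y, z} \<in> M \<or> {y, z} = {u, v}" by auto
    then have "joined M y z"
      using assms joined_sym joined_edge by (metis doubleton_eq_iff)
    then show ?case using step joined_trans by metis
  qed
next
  fix x y
  show "joined M x y \<Longrightarrow> joined (insert {u, v} M) x y"
    by (rule joined_mono[OF subset_insertI])
qed

section \<open>Faces of a plane graph\<close>

text \<open>Otherwise the inverse of the arc would embed an open subset of the plane into the line.\<close>
lemma arc_image_not_superset_open:
  fixes g :: "real \<Rightarrow> complex"
  assumes "arc g" "open S" "S \<noteq> {}"
  shows "\<not> S \<subseteq> path_image g"
proof
  assume S: "S \<subseteq> path_image g"
  have cont: "continuous_on {0..1} g" and inj: "inj_on g {0..1}"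
    using assms(1) by (auto simp: arc_def path_def)
  have "continuous_on (path_image g) (inv_into {0..1} g)"
    unfolding path_image_def using inj by (intro continuous_on_inv[OF cont]) auto
  then have "continuous_on S (inv_into {0..1} g)"
    using S continuous_on_subset by blast
  moreover have "inj_on (inv_into {0..1} g) S"
    using S unfolding path_image_def by (rule inj_on_inv_into)
  ultimately have "DIM(complex) \<le> DIM(real)"
    using invariance_of_dimension assms(2,3) by blast
  then show False by simp
qed

text \<open>A finite graph drawn in the plane with Jordan arcs as edges. The vertex set stays fixed, and the
  subgraphs considered are given by edge sets \<open>M \<subseteq> E\<close>.\<close>
locale plane_graph =
  fixes V :: "'a set" and E :: "'a set set"
    and pos :: "'a \<Rightarrow> complex" and \<gamma> :: "'a set \<Rightarrow> real \<Rightarrow> complex"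
  assumes finite_V: "finite V"
    and edge: "e \<in> E \<Longrightarrow> \<exists>u v. e = {u, v} \<and> u \<noteq> v \<and> u \<in> V \<and> v \<in> V"
    and inj_pos: "inj_on pos V"
    and arc_edge: "e \<in> E \<Longrightarrow> arc (\<gamma> e)"
    and ends_edge: "e \<in> E \<Longrightarrow> {pathstart (\<gamma> e), pathfinish (\<gamma> e)} = pos ` e"
    and vertices_on_edge: "e \<in> E \<Longrightarrow> path_image (\<gamma> e) \<inter> pos ` V = pos ` e"
    and edges_meet: "e \<in> E \<Longrightarrow> f \<in> E \<Longrightarrow> e \<noteq> f \<Longrightarrow>
      path_image (\<gamma> e) \<inter> path_image (\<gamma> f) \<subseteq> pos ` V"
begin

definition drawing :: "'a set set \<Rightarrow> complex set" where
  "drawing M = pos ` V \<union> (\<Union>e\<in>M. path_image (\<gamma> e))"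

definition faces :: "'a set set \<Rightarrow> complex set set" where
  "faces M = components (- drawing M)"

abbreviation same_face :: "'a set set \<Rightarrow> complex \<Rightarrow> complex \<Rightarrow> bool" where
  "same_face M \<equiv> connected_component (- drawing M)"

lemma edge_subset: "e \<in> E \<Longrightarrow> e \<subseteq> V"
  using edge by blast

lemma finite_E: "finite E"
proof (rule finite_subset)
  show "E \<subseteq> Pow V" using edge_subset by blast
qed (simp add: finite_V)

lemma drawing_empty [simp]: "drawing {} = pos ` V"
  by (simp add: drawing_def)

lemma drawing_insert: "drawing (insert e M) = drawing M \<union> path_image (\<gamma> e)"
  by (auto simp: drawing_def)

lemma drawing_mono: "M \<subseteq> M' \<Longrightarrow> drawing M \<subseteq> drawing M'"
  by (auto simp: drawing_def)

lemma compact_drawing: "M \<subseteq> E \<Longrightarrow> compact (drawing M)"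
  unfolding drawing_def
  by (intro compact_Un compact_UN finite_imp_compact[OF finite_imageI[OF finite_V]])
     (auto intro: finite_subset[OF _ finite_E] compact_arc_image arc_edge)

lemma open_Compl_drawing: "M \<subseteq> E \<Longrightarrow> open (- drawing M)"
  using compact_drawing compact_imp_closed by blast

lemma drawing_Int_edge:
  assumes "M \<subseteq> E" "e \<in> E" "e \<notin> M"
  shows "drawing M \<inter> path_image (\<gamma> e) = pos ` e"
proof -
  have "path_image (\<gamma> f) \<inter> path_image (\<gamma> e) \<subseteq> pos ` e" if "f \<in> M" for f
    using edges_meet[of f e] vertices_on_edge[of e] assms that by blast
  then show ?thesis
    using vertices_on_edge[OF assms(2)] unfolding drawing_def by blast
qed

lemma path_component_drawing:
  assumes "M \<subseteq> E" "joined M u v" "u \<in> V"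
  shows "path_component (drawing M) (pos u) (pos v)"
  using assms(2) unfolding joined_def
proof (induction rule: rtrancl_induct)
  case base
  then show ?case using assms(3) by (simp add: path_component_refl drawing_def)
next
  case (step y z)
  then have e: "{y, z} \<in> M" by simp
  then have "{pathstart (\<gamma> {y, z}), pathfinish (\<gamma> {y, z})} = {pos y, pos z}"
    using ends_edge assms(1) by fastforce
  moreover have "path (\<gamma> {y, z})" "path_image (\<gamma> {y, z}) \<subseteq> drawing M"
    using arc_edge assms(1) e arc_imp_path by (auto simp: drawing_def)
  ultimately have "path_component (drawing M) (pos y) (pos z)"
    unfolding path_component_def
    by (metis doubleton_eq_iff path_image_reversepath path_reversepath
        pathfinish_reversepath pathstart_reversepath)
  then show ?case using step path_component_trans by metis
qed

text \<open>The points \<open>pos u\<close> and \<open>pos v\<close> lie in one path component of the drawing, and a path between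
  them contains an arc. Together with the new edge it forms a Jordan curve that meets the old drawing
  exactly in that arc.\<close>
lemma closing_curve:
  assumes M: "M \<subseteq> E" and e: "{u, v} \<in> E" "{u, v} \<notin> M" and "joined M u v"
  obtains c where "simple_path c" "pathfinish c = pathstart c"
    "drawing M \<union> path_image c = drawing (insert {u, v} M)"
    "connected (drawing M \<inter> path_image c)"
    "path_image (\<gamma> {u, v}) \<subseteq> path_image c"
proof -
  let ?g = "\<gamma> {u, v}"
  have uv: "u \<in> V" "v \<in> V" "u \<noteq> v"
    using edge[OF e(1)] by (auto simp: doubleton_eq_iff)
  then have ne: "pos u \<noteq> pos v" using inj_pos by (auto dest: inj_onD)
  have ends: "{pathstart ?g, pathfinish ?g} = {pos u, pos v}" using ends_edge[OF e(1)] by simp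
  have "path_component (drawing M) (pos u) (pos v)"
    using path_component_drawing assms uv by blast
  then have "path_component (drawing M) (pathfinish ?g) (pathstart ?g)"
    using ends by (metis doubleton_eq_iff path_component_sym)
  then obtain h where h: "path h" "path_image h \<subseteq> drawing M"
    "pathstart h = pathfinish ?g" "pathfinish h = pathstart ?g"
    unfolding path_component_def by blast
  have "pathfinish ?g \<noteq> pathstart ?g" using ends ne by (metis doubleton_eq_iff)
  from path_contains_arc[OF h(1,3,4) this]
  obtain q where q: "arc q" "path_image q \<subseteq> path_image h"
    "pathstart q = pathfinish ?g" "pathfinish q = pathstart ?g"
    by blast
  have meet: "drawing M \<inter> path_image ?g = {pathstart ?g, pathfinish ?g}"
    using drawing_Int_edge[OF M e] ends by simp
  have q_sub: "path_image q \<subseteq> drawing M" using q(2) h(2) by blast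
  have img: "path_image (?g +++ q) = path_image ?g \<union> path_image q"
    using q(3) by (simp add: path_image_join)
  show thesis
  proof
    show "simple_path (?g +++ q)"
      using arc_edge[OF e(1)] q meet q_sub by (intro simple_path_join_loop) auto
    show "pathfinish (?g +++ q) = pathstart (?g +++ q)" by (simp add: q)
    show "drawing M \<union> path_image (?g +++ q) = drawing (insert {u, v} M)"
      using q_sub by (auto simp: img drawing_insert)
    have "{pathstart ?g, pathfinish ?g} \<subseteq> path_image q"
      using q(3,4) by (metis empty_subsetI insert_subset pathfinish_in_path_image pathstart_in_path_image)
    then have "drawing M \<inter> path_image (?g +++ q) = path_image q"
      unfolding img using meet q_sub by blast
    then show "connected (drawing M \<inter> path_image (?g +++ q))"
      using q(1) connected_arc_image by metis
    show "path_image ?g \<subseteq> path_image (?g +++ q)" using img by blast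
  qed
qed

text \<open>The drawing falls into two disjoint compact parts \<open>K1\<close> and \<open>K2\<close>, one around \<open>u\<close> and one around
  \<open>v\<close>. Neither part, nor the arc of the new edge, separates the two points; gluing first \<open>K1\<close> and
  the arc and then \<open>K2\<close> together along single points does not separate them either, by Janiszewski's
  theorem.\<close>
lemma same_face_insert_bridge:
  assumes M: "M \<subseteq> E" and e: "{u, v} \<in> E" and nj: "\<not> joined M u v"
    and pq: "same_face M p q" "p \<notin> path_image (\<gamma> {u, v})" "q \<notin> path_image (\<gamma> {u, v})"
  shows "same_face (insert {u, v} M) p q"
proof -
  let ?g = "path_image (\<gamma> {u, v})"
  have eM: "{u, v} \<notin> M" using nj joined_edge[of u v M] by auto
  have uv: "u \<in> V" "v \<in> V" "u \<noteq> v"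
    using edge[OF e(1)] by (auto simp: doubleton_eq_iff)
  \<comment> \<open>\<open>U\<close> is the cluster of \<open>u\<close>; no edge of \<open>M\<close> leaves it\<close>
  define U where "U = {w \<in> V. joined M u w}"
  define K1 where "K1 = pos ` U \<union> (\<Union>f\<in>{f\<in>M. f \<subseteq> U}. path_image (\<gamma> f))"
  define K2 where "K2 = pos ` (V - U) \<union> (\<Union>f\<in>{f\<in>M. f \<inter> U = {}}. path_image (\<gamma> f))"
  have "f \<subseteq> U \<or> f \<inter> U = {}" if f: "f \<in> M" for f
  proof -
    obtain x y where xy: "f = {x, y}" "x \<in> V" "y \<in> V" using edge f M by blast
    then have "joined M x y" "joined M y x" using f joined_edge joined_sym by metis+
    then have "joined M u x \<longleftrightarrow> joined M u y" using joined_trans by metis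
    then show ?thesis using xy by (auto simp: U_def)
  qed
  then have split: "{f\<in>M. f \<subseteq> U} \<union> {f\<in>M. f \<inter> U = {}} = M" by blast
  have "U \<subseteq> V" by (auto simp: U_def)
  then have "drawing M = K1 \<union> K2"
    unfolding drawing_def K1_def K2_def using split by blast
  have fin: "finite M" "finite V" "finite U" using M finite_E finite_V \<open>U \<subseteq> V\<close> by (auto intro: finite_subset)
  have comp: "compact K1" "compact K2" "compact ?g"
    unfolding K1_def K2_def using M e fin
    by (auto intro!: compact_Un compact_UN finite_imp_compact[OF finite_imageI]
        intro: compact_arc_image arc_edge)
  have on: "x \<in> path_image (\<gamma> f) \<Longrightarrow> x \<in> pos ` V \<Longrightarrow> x \<in> pos ` f" if "f \<in> M" for f x
    using vertices_on_edge[of f] that M by blast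
  have two: "x \<in> path_image (\<gamma> f) \<Longrightarrow> x \<in> path_image (\<gamma> f') \<Longrightarrow> x \<in> pos ` V"
    if "f \<in> E" "f' \<in> E" "f \<noteq> f'" for f f' x
    using edges_meet[of f f'] that by blast
  have K1V: "K1 \<inter> pos ` V \<subseteq> pos ` U"
  proof
    fix x assume "x \<in> K1 \<inter> pos ` V"
    then show "x \<in> pos ` U" using on unfolding K1_def by blast
  qed
  have K2V: "K2 \<inter> pos ` V \<subseteq> pos ` (V - U)"
  proof
    fix x assume x: "x \<in> K2 \<inter> pos ` V"
    then consider "x \<in> pos ` (V - U)" | f where "f \<in> M" "f \<inter> U = {}" "x \<in> path_image (\<gamma> f)"
      unfolding K2_def by blast
    then show "x \<in> pos ` (V - U)"
    proof cases
      case 2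
      then have "x \<in> pos ` f" using on x by blast
      moreover have "f \<subseteq> V - U" using 2 edge_subset M by blast
      ultimately show ?thesis by blast
    qed
  qed
  have U_disj: "pos ` U \<inter> pos ` (V - U) = {}"
    using inj_pos \<open>U \<subseteq> V\<close> by (auto simp: inj_on_def)
  have "K1 \<inter> K2 \<subseteq> pos ` V"
  proof
    fix x assume x: "x \<in> K1 \<inter> K2"
    show "x \<in> pos ` V"
    proof (rule ccontr)
      assume "x \<notin> pos ` V"
      then obtain f f' where "f \<in> M" "f \<subseteq> U" "x \<in> path_image (\<gamma> f)"
        "f' \<in> M" "f' \<inter> U = {}" "x \<in> path_image (\<gamma> f')"
        using x \<open>U \<subseteq> V\<close> unfolding K1_def K2_def by blast
      moreover have "f \<noteq> f'" using calculation edge[of f] M by blast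
      ultimately show False using two \<open>x \<notin> pos ` V\<close> M by blast
    qed
  qed
  then have K12: "K1 \<inter> K2 = {}" using K1V K2V U_disj by blast
  have g_dr: "(K1 \<union> K2) \<inter> ?g = {pos u, pos v}"
    using drawing_Int_edge[OF M e eM] \<open>drawing M = K1 \<union> K2\<close> by simp
  have u: "u \<in> U" "v \<in> V - U" using uv nj by (auto simp: U_def)
  then have in_K: "pos u \<in> K1" "pos v \<in> K2" by (auto simp: K1_def K2_def)
  then have "pos u \<notin> K2" "pos v \<notin> K1" using K12 by auto
  moreover have "x = pos u \<or> x = pos v" if "x \<in> K1 \<union> K2" "x \<in> ?g" for x
    using g_dr IntI[OF that] by simp
  moreover have "pos u \<in> ?g" "pos v \<in> ?g" using equalityD2[OF g_dr] by simp_all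
  ultimately have meet: "K1 \<inter> ?g = {pos u}" "K2 \<inter> ?g = {pos v}"
    using in_K by (fastforce simp: set_eq_iff)+
  have c1: "connected_component (- K1) p q" "connected_component (- K2) p q"
    using pq(1) \<open>drawing M = K1 \<union> K2\<close>
    by (auto elim!: connected_component_of_subset)
  have "connected (- ?g)"
    using arc_edge[OF e] by (intro connected_arc_complement) auto
  then have c2: "connected_component (- ?g) p q"
    using pq by (auto simp: connected_component_def)
  have c3: "connected_component (- (K1 \<union> ?g)) p q"
    using Janiszewski[OF comp(1) compact_imp_closed[OF comp(3)] _ c1(1) c2] meet by simp
  have "(K1 \<union> ?g) \<inter> K2 = {pos v}"
    using meet(2) K12 by auto
  then have "connected ((K1 \<union> ?g) \<inter> K2)" by simp
  from Janiszewski[OF compact_Un[OF comp(1,3)] compact_imp_closed[OF comp(2)] this c3 c1(2)]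
  have "connected_component (- ((K1 \<union> ?g) \<union> K2)) p q" .
  moreover have "(K1 \<union> ?g) \<union> K2 = drawing (insert {u, v} M)"
    using \<open>drawing M = K1 \<union> K2\<close> by (auto simp: drawing_insert)
  ultimately show ?thesis by simp
qed

text \<open>Here \<open>S\<close> is the inside of the closing curve. That the curve meets the drawing in a connected set
  is what Janiszewski's theorem needs to show that points on the same side of the curve stay in one
  face. Points on both sides are found near an inner point of the new edge, because the curve is the
  frontier of both its inside and its outside.\<close>
lemma same_face_insert_closing:
  assumes M: "M \<subseteq> E" and e: "{u, v} \<in> E" "{u, v} \<notin> M" and j: "joined M u v"
  obtains S where
    "\<And>p q. same_face M p q \<Longrightarrow> p \<notin> path_image (\<gamma> {u, v}) \<Longrightarrow> q \<notin> path_image (\<gamma> {u, v}) \<Longrightarrow>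
      (p \<in> S \<longleftrightarrow> q \<in> S) \<Longrightarrow> same_face (insert {u, v} M) p q"
    "\<And>p q. same_face (insert {u, v} M) p q \<Longrightarrow> p \<in> S \<longleftrightarrow> q \<in> S"
    "\<exists>p q. same_face M p q \<and> p \<notin> path_image (\<gamma> {u, v}) \<and> q \<notin> path_image (\<gamma> {u, v}) \<and>
      p \<in> S \<and> q \<notin> S"
proof -
  let ?g = "path_image (\<gamma> {u, v})"
  obtain c where c: "simple_path c" "pathfinish c = pathstart c"
    "drawing M \<union> path_image c = drawing (insert {u, v} M)"
    "connected (drawing M \<inter> path_image c)" "?g \<subseteq> path_image c"
    using closing_curve[OF M e j] by metis
  let ?C = "path_image c" let ?in = "inside ?C" let ?out = "outside ?C"
  have J: "open ?in" "connected ?in" "open ?out" "connected ?out" "?in \<inter> ?out = {}"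
    "?in \<union> ?out = - ?C" "frontier ?in = ?C" "frontier ?out = ?C"
    using Jordan_inside_outside[OF c(1,2)] by auto
  have gC: "drawing M \<union> ?C = drawing M \<union> ?g"
    using c(3) by (simp add: drawing_insert)
  show thesis
  proof
    fix p q
    assume pq: "same_face M p q" "p \<notin> ?g" "q \<notin> ?g" "p \<in> ?in \<longleftrightarrow> q \<in> ?in"
    have "p \<notin> drawing M" "q \<notin> drawing M"
      using connected_component_in[OF pq(1)] by auto
    then have "p \<notin> ?C" "q \<notin> ?C" using gC pq by blast+
    then have "p \<in> ?in \<and> q \<in> ?in \<or> p \<in> ?out \<and> q \<in> ?out"
      using J(6) pq(4) by blast
    then have "connected_component (- ?C) p q"
      unfolding connected_component_def using J(2,4,6) by blast
    then have "connected_component (- (drawing M \<union> ?C)) p q"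
      using Janiszewski[OF compact_drawing[OF M] closed_simple_path_image[OF c(1)] c(4) pq(1)]
      by blast
    then show "same_face (insert {u, v} M) p q" using c(3) by simp
  next
    fix p q
    assume "same_face (insert {u, v} M) p q"
    then obtain T where T: "connected T" "T \<subseteq> - drawing (insert {u, v} M)" "p \<in> T" "q \<in> T"
      by (auto simp: connected_component_def)
    then have "T \<subseteq> ?in \<union> ?out" using c(3) J(6) by blast
    then have "?in \<inter> T = {} \<or> ?out \<inter> T = {}"
      using connectedD[OF T(1) J(1,3)] J(5) by blast
    then show "p \<in> ?in \<longleftrightarrow> q \<in> ?in"
      using T \<open>T \<subseteq> ?in \<union> ?out\<close> by blast
  next
    \<comment> \<open>an inner point of the new edge, hence off the old drawing\<close>
    define z where "z = \<gamma> {u, v} (1 / 2)"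
    have inj: "inj_on (\<gamma> {u, v}) {0..1}" using arc_edge[OF e(1)] by (simp add: arc_def)
    have z: "z \<in> ?g" by (auto simp: z_def path_image_def)
    have "z \<noteq> pathstart (\<gamma> {u, v})" "z \<noteq> pathfinish (\<gamma> {u, v})"
      unfolding z_def pathstart_def pathfinish_def
      using inj_onD[OF inj, of "1/2" 0] inj_onD[OF inj, of "1/2" 1] by auto
    then have "z \<notin> pos ` {u, v}" using ends_edge[OF e(1)] by auto
    then have "z \<in> - drawing M" using drawing_Int_edge[OF M e] z by blast
    then obtain r where r: "r > 0" "ball z r \<subseteq> - drawing M"
      using open_Compl_drawing[OF M] open_contains_ball by blast
    have "z \<in> closure ?in" "z \<in> closure ?out"
      using z c(5) J(7,8) by (auto simp: frontier_def)
    then obtain p q where p: "p \<in> ?in" "dist p z < r" and q: "q \<in> ?out" "dist q z < r"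
      using r(1) closure_approachable by metis
    then have "p \<in> ball z r" "q \<in> ball z r" by (auto simp: dist_commute)
    then have "same_face M p q"
      unfolding connected_component_def using r(2) by (intro exI[of _ "ball z r"]) auto
    moreover have "p \<notin> ?g" "q \<notin> ?g" "q \<notin> ?in" using p q J(5,6) c(5) by blast+
    ultimately show "\<exists>p q. same_face M p q \<and> p \<notin> ?g \<and> q \<notin> ?g \<and> p \<in> ?in \<and> q \<notin> ?in"
      using p by blast
  qed
qed

text \<open>For a bridge \<open>S = {}\<close> will do, otherwise the inside of the closing curve.\<close>
lemma two_sides:
  assumes M: "M \<subseteq> E" and e: "e \<in> E" "e \<notin> M"
  obtains S where "\<And>p q. same_face M p q \<Longrightarrow> p \<notin> path_image (\<gamma> e) \<Longrightarrow> q \<notin> path_image (\<gamma> e) \<Longrightarrow>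
      (p \<in> S \<longleftrightarrow> q \<in> S) \<Longrightarrow> same_face (insert e M) p q"
proof -
  obtain u v where uv: "e = {u, v}" using edge[OF e(1)] by blast
  show thesis
  proof (cases "joined M u v")
    case True
    then show thesis
      using same_face_insert_closing[OF M, of u v] e that unfolding uv by metis
  next
    case False
    then show thesis
      using same_face_insert_bridge[OF M, of u v] e that[of "{}"] unfolding uv by metis
  qed
qed

lemma faceE:
  assumes "F \<in> faces M"
  obtains p where "p \<in> F" "p \<notin> drawing M" "F = connected_component_set (- drawing M) p"
  using assms unfolding faces_def components_def by (auto simp: connected_component_refl_eq)

lemma face_of_point: "p \<notin> drawing M \<Longrightarrow> connected_component_set (- drawing M) p \<in> faces M"
  by (auto simp: faces_def components_def)

lemma face_eq: "F \<in> faces M \<Longrightarrow> p \<in> F \<Longrightarrow> F = connected_component_set (- drawing M) p"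
  unfolding faces_def components_def using connected_component_eq by fastforce

lemma face_subset: "F \<in> faces M \<Longrightarrow> F \<subseteq> - drawing M"
  unfolding faces_def by (rule in_components_subset)

lemma same_face_mono: "M \<subseteq> M' \<Longrightarrow> same_face M' p q \<Longrightarrow> same_face M p q"
  by (rule connected_component_of_subset) (use drawing_mono in auto)

text \<open>The choice of the point is immaterial: all points of a face of a larger drawing lie in one face of
  a smaller one.\<close>
definition parent_face :: "'a set set \<Rightarrow> complex set \<Rightarrow> complex set" where
  "parent_face M F = connected_component_set (- drawing M) (SOME x. x \<in> F)"

lemma parent_face_eq:
  assumes "M \<subseteq> M'" "F \<in> faces M'" "p \<in> F"
  shows "parent_face M F = connected_component_set (- drawing M) p"
proof -
  define q where "q = (SOME x. x \<in> F)"
  have "q \<in> F" unfolding q_def using assms(3) by (rule someI)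
  then have "same_face M' p q" using face_eq[OF assms(2,3)] by auto
  then have "same_face M p q" using same_face_mono[OF assms(1)] by blast
  then show ?thesis unfolding parent_face_def q_def[symmetric]
    using connected_component_eq by fastforce
qed

text \<open>No face disappears, since a face is open and cannot be covered by the new arc.\<close>
lemma parent_face_image:
  assumes "M \<subseteq> E" "e \<in> E"
  shows "parent_face M ` faces (insert e M) = faces M"
proof (intro equalityI subsetI)
  fix D assume "D \<in> parent_face M ` faces (insert e M)"
  then obtain F where F: "F \<in> faces (insert e M)" "D = parent_face M F" by blast
  obtain p where p: "p \<in> F" "p \<notin> drawing (insert e M)" using faceE[OF F(1)] by metis
  then have "D = connected_component_set (- drawing M) p"
    using parent_face_eq[OF subset_insertI F(1)] F(2) by blast
  then show "D \<in> faces M" using face_of_point[of p M] p(2) by (auto simp: drawing_insert)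
next
  fix D assume D: "D \<in> faces M"
  then have "open D" "D \<noteq> {}"
    using open_components[OF open_Compl_drawing[OF assms(1)]] in_components_nonempty
    unfolding faces_def by blast+
  then obtain p where p: "p \<in> D" "p \<notin> path_image (\<gamma> e)"
    using arc_image_not_superset_open[OF arc_edge[OF assms(2)]] by blast
  then have p': "p \<notin> drawing (insert e M)" using face_subset[OF D] by (auto simp: drawing_insert)
  let ?F = "connected_component_set (- drawing (insert e M)) p"
  have F: "?F \<in> faces (insert e M)" by (rule face_of_point[OF p'])
  have "parent_face M ?F = D"
    using parent_face_eq[OF subset_insertI F, of p] face_eq[OF D p(1)] p'
    by (simp add: connected_component_refl_eq)
  then show "D \<in> parent_face M ` faces (insert e M)" using F by blast
qed

text \<open>A face inside \<open>D\<close> is determined by the side of \<open>S\<close> on which one of its points lies.\<close>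
lemma card_faces_in_face:
  assumes M: "M \<subseteq> E" and e: "e \<in> E" "e \<notin> M" and D: "D \<in> faces M"
  shows "finite {F \<in> faces (insert e M). F \<subseteq> D}" "card {F \<in> faces (insert e M). F \<subseteq> D} \<le> 2"
proof -
  obtain S where S: "\<And>p q. same_face M p q \<Longrightarrow> p \<notin> path_image (\<gamma> e) \<Longrightarrow> q \<notin> path_image (\<gamma> e) \<Longrightarrow>
      (p \<in> S \<longleftrightarrow> q \<in> S) \<Longrightarrow> same_face (insert e M) p q"
    using two_sides[OF M e] by metis
  let ?A = "{F \<in> faces (insert e M). F \<subseteq> D}"
  define rep where "rep F = (SOME x. x \<in> F)" for F :: "complex set"
  have rep: "rep F \<in> F" if "F \<in> ?A" for F
    using that faceE[of F "insert e M"] unfolding rep_def by (metis (mono_tags, lifting) mem_Collect_eq someI)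
  have inj: "inj_on (\<lambda>F. rep F \<in> S) ?A"
  proof (rule inj_onI)
    fix F F' assume F: "F \<in> ?A" "F' \<in> ?A" and same: "(rep F \<in> S) = (rep F' \<in> S)"
    have "rep F \<in> D" "rep F' \<in> D" using rep F by blast+
    then have "same_face M (rep F) (rep F')" using face_eq[OF D] by blast
    moreover have "rep F \<notin> path_image (\<gamma> e)" "rep F' \<notin> path_image (\<gamma> e)"
      using rep[OF F(1)] rep[OF F(2)] F face_subset[of F "insert e M"] face_subset[of F' "insert e M"]
      by (auto simp: drawing_insert)
    ultimately have "same_face (insert e M) (rep F) (rep F')" using S same by blast
    then have "rep F' \<in> F" using face_eq[of F "insert e M" "rep F"] F rep by blast
    then show "F = F'" using face_eq[of F "insert e M" "rep F'"] face_eq[of F' "insert e M" "rep F'"] F rep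
      by blast
  qed
  show "finite ?A" by (rule inj_on_finite[OF inj, of UNIV]) auto
  show "card ?A \<le> 2" using card_inj_on_le[OF inj, of UNIV] by simp
qed

lemma faces_empty: "faces {} = {- (pos ` V)}"
proof -
  have fin: "finite (pos ` V)" using finite_V by simp
  then have "connected (UNIV - pos ` V)"
    by (intro connected_open_delete_finite) auto
  moreover have "- (pos ` V) \<noteq> {}"
    using fin infinite_UNIV_char_0[where 'a = complex] by (metis Compl_empty_eq double_compl)
  ultimately show ?thesis
    unfolding faces_def by (simp add: Compl_eq_Diff_UNIV components_eq_sing_iff)
qed

lemma finite_faces:
  assumes "M \<subseteq> E"
  shows "finite (faces M)"
  using finite_subset[OF assms finite_E] assms
proof (induction M rule: finite_induct)
  case empty
  then show ?case by (simp add: faces_empty)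
next
  case (insert e M)
  have "faces (insert e M) \<subseteq> (\<Union>D\<in>faces M. {F \<in> faces (insert e M). F \<subseteq> D})"
  proof
    fix F assume F: "F \<in> faces (insert e M)"
    then obtain p where p: "p \<in> F" "p \<notin> drawing (insert e M)" by (metis faceE)
    let ?D = "connected_component_set (- drawing M) p"
    have "?D \<in> faces M" using p by (intro face_of_point) (auto simp: drawing_insert)
    moreover have "F \<subseteq> ?D"
      using face_eq[OF F p(1)] same_face_mono[OF subset_insertI] by auto
    ultimately show "F \<in> (\<Union>D\<in>faces M. {F \<in> faces (insert e M). F \<subseteq> D})" using F by blast
  qed
  moreover have "finite (\<Union>D\<in>faces M. {F \<in> faces (insert e M). F \<subseteq> D})"
    using insert card_faces_in_face(1)[of M e] by auto
  ultimately show ?case by (rule finite_subset)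
qed

lemma card_faces_insert:
  assumes "M \<subseteq> E" "e \<in> E"
  shows "card (faces M) \<le> card (faces (insert e M))"
  using card_image_le[OF finite_faces, of "insert e M" "parent_face M"] parent_face_image[OF assms] assms
  by simp

lemma card_faces_insert_closing:
  assumes M: "M \<subseteq> E" and e: "{u, v} \<in> E" "{u, v} \<notin> M" and j: "joined M u v"
  shows "card (faces M) < card (faces (insert {u, v} M))"
proof -
  let ?M = "insert {u, v} M"
  obtain S p q where S: "\<And>p q. same_face ?M p q \<Longrightarrow> p \<in> S \<longleftrightarrow> q \<in> S"
    and pq: "same_face M p q" "p \<notin> path_image (\<gamma> {u, v})" "q \<notin> path_image (\<gamma> {u, v})"
      "p \<in> S" "q \<notin> S"
    using same_face_insert_closing[OF assms] by metis
  let ?F = "\<lambda>M p. connected_component_set (- drawing M) p"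
  have p: "p \<notin> drawing ?M" "q \<notin> drawing ?M"
    using connected_component_in[OF pq(1)] pq by (auto simp: drawing_insert)
  then have F: "?F ?M p \<in> faces ?M" "?F ?M q \<in> faces ?M" by (auto intro: face_of_point)
  have in_F: "p \<in> ?F ?M p" "q \<in> ?F ?M q" using p by (auto simp: connected_component_refl_eq)
  have "parent_face M (?F ?M p) = parent_face M (?F ?M q)"
    using parent_face_eq[OF subset_insertI F(1) in_F(1)] parent_face_eq[OF subset_insertI F(2) in_F(2)]
      connected_component_eq[of q "- drawing M" p] pq(1) by simp
  moreover have "?F ?M p \<noteq> ?F ?M q"
  proof
    assume "?F ?M p = ?F ?M q"
    then have "q \<in> ?F ?M p" using in_F(2) by blast
    then show False using S[of p q] pq(4,5) by simp
  qed
  ultimately have "\<not> inj_on (parent_face M) (faces ?M)" using F by (auto simp: inj_on_def)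
  moreover have "finite (faces ?M)" using finite_faces M e by simp
  ultimately have "card (parent_face M ` faces ?M) < card (faces ?M)"
    using card_image_le eq_card_imp_inj_on by (metis le_neq_implies_less)
  then show ?thesis using parent_face_image[OF M e(1)] by simp
qed

text \<open>The vertex sets of the connected components of the graph with edge set \<open>M\<close>.\<close>
definition clusters :: "'a set set \<Rightarrow> 'a set set" where
  "clusters M = (\<lambda>u. {w \<in> V. joined M u w}) ` V"

lemma card_clusters_insert_bridge:
  assumes "{u, v} \<in> E" "\<not> joined M u v"
  shows "card (clusters (insert {u, v} M)) < card (clusters M)"
proof -
  let ?M = "insert {u, v} M"
  have uv: "u \<in> V" "v \<in> V" using edge[OF assms(1)] by (auto simp: doubleton_eq_iff)
  let ?cl = "\<lambda>M u. {w \<in> V. joined M u w}"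
  define f where "f C = {w \<in> V. \<exists>x\<in>C. joined ?M x w}" for C
  have f: "f (?cl M x) = ?cl ?M x" if "x \<in> V" for x
    unfolding f_def using that joined_mono[OF subset_insertI] joined_trans joined_refl by fastforce
  then have img: "f ` clusters M = clusters ?M" unfolding clusters_def by force
  have "joined ?M u v" by (rule joined_edge) simp
  then have "?cl ?M u = ?cl ?M v" using joined_trans joined_sym by fast
  then have "f (?cl M u) = f (?cl M v)" using f uv by simp
  moreover have "v \<in> ?cl M v" "v \<notin> ?cl M u" using uv assms(2) by simp_all
  then have "?cl M u \<noteq> ?cl M v" by metis
  moreover have "?cl M u \<in> clusters M" "?cl M v \<in> clusters M" using uv by (simp_all add: clusters_def)
  ultimately have "\<not> inj_on f (clusters M)" by (metis inj_onD)
  moreover have "finite (clusters M)" using finite_V by (simp add: clusters_def)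
  ultimately show ?thesis
    using card_image_le eq_card_imp_inj_on img by (metis le_neq_implies_less)
qed

text \<open>One half of Euler's formula, by adding the edges one at a time: an edge either merges two clusters
  or creates a face.\<close>
lemma euler_inequality:
  assumes "M \<subseteq> E"
  shows "card M + card (clusters M) + 1 \<le> card V + card (faces M)"
  using finite_subset[OF assms finite_E] assms
proof (induction M rule: finite_induct)
  case empty
  have "card (clusters {}) \<le> card V" unfolding clusters_def by (rule card_image_le[OF finite_V])
  then show ?case by (simp add: faces_empty)
next
  case (insert e M)
  then have M: "M \<subseteq> E" and e: "e \<in> E" by auto
  obtain u v where uv: "e = {u, v}" using edge[OF e] by blast
  show ?case
  proof (cases "joined M u v")
    case True
    then have "clusters (insert e M) = clusters M"
      by (simp add: clusters_def uv joined_insert_joined)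
    then show ?thesis
      using card_faces_insert_closing[OF M _ _ True] insert e unfolding uv by simp
  next
    case False
    then show ?thesis
      using card_clusters_insert_bridge[of u v M] card_faces_insert[OF M e] insert e unfolding uv by simp
  qed
qed

text \<open>The ends of an edge are left out because a vertex may lie on many faces.\<close>
definition border :: "complex set \<Rightarrow> 'a set set" where
  "border F = {e \<in> E. closure F \<inter> (path_image (\<gamma> e) - pos ` e) \<noteq> {}}"

text \<open>Remove \<open>e\<close>: its interior then lies in a single face \<open>D\<close>. Every face that has \<open>e\<close> on its border
  lies in \<open>D\<close>, and adding \<open>e\<close> back splits \<open>D\<close> into at most two faces.\<close>
lemma card_faces_at_edge:
  assumes e: "e \<in> E"
  shows "card {F \<in> faces E. e \<in> border F} \<le> 2"
proof -
  let ?M = "E - {e}" let ?O = "path_image (\<gamma> e) - pos ` e"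
  have M: "?M \<subseteq> E" "insert e ?M = E" "e \<notin> ?M" using e by auto
  have "connected ?O"
    using connected_simple_path_endless[OF arc_imp_simple_path[OF arc_edge[OF e]]] ends_edge[OF e] by simp
  moreover have sub: "?O \<subseteq> - drawing ?M" using drawing_Int_edge[OF M(1) e M(3)] by blast
  show ?thesis
  proof (cases "?O = {}")
    case True
    then have "{F \<in> faces E. e \<in> border F} = {}" unfolding border_def by blast
    then show ?thesis by (simp only: card.empty zero_le)
  next
    case False
    then obtain z where z: "z \<in> ?O" by blast
    define D where "D = connected_component_set (- drawing ?M) z"
    have D: "D \<in> faces ?M" unfolding D_def using z sub by (intro face_of_point) blast
    have OD: "?O \<subseteq> D" unfolding D_def
      by (rule connected_component_maximal[OF z \<open>connected ?O\<close> sub])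
    have "open D" using D open_components[OF open_Compl_drawing[OF M(1)]] unfolding faces_def by blast
    have "F \<subseteq> D" if F: "F \<in> faces E" "e \<in> border F" for F
    proof -
      have "closure F \<inter> D \<noteq> {}" using F(2) OD unfolding border_def by blast
      then have "D \<inter> F \<noteq> {}" using open_Int_closure_eq_empty[OF \<open>open D\<close>, of F] by blast
      moreover have "connected F" using F(1) in_components_connected unfolding faces_def by blast
      moreover have "F \<subseteq> - drawing ?M" using face_subset[OF F(1)] drawing_mono[OF M(1)] by blast
      ultimately show "F \<subseteq> D" using components_maximal D unfolding faces_def by blast
    qed
    then have "{F \<in> faces E. e \<in> border F} \<subseteq> {F \<in> faces (insert e ?M). F \<subseteq> D}" unfolding M(2) by blast
    from card_mono[OF card_faces_in_face(1)[OF M(1) e M(3) D] this]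
    show ?thesis using card_faces_in_face(2)[OF M(1) e M(3) D] by (rule order_trans)
  qed
qed

text \<open>A connected set that meets \<open>F\<close> and another face meets the frontier of \<open>F\<close>, which is covered by
  the vertices and the edges on its border.\<close>
lemma border_separates:
  assumes F: "F \<in> faces E" and "card (faces E) \<ge> 2"
  shows "\<not> connected (- drawing (border F))"
proof
  assume con: "connected (- drawing (border F))"
  have "faces E \<noteq> {F}" using assms(2) by auto
  then obtain F' where F': "F' \<in> faces E" "F' \<noteq> F" using F by blast
  obtain p where p: "p \<in> F" using faceE[OF F] by metis
  obtain q where q: "q \<in> F'" using faceE[OF F'(1)] by metis
  have "q \<notin> F" using face_eq[OF F] face_eq[OF F'(1) q] F'(2) by blast
  have BE: "border F \<subseteq> E" by (auto simp: border_def)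
  then have "p \<notin> drawing (border F)" "q \<notin> drawing (border F)"
    using p q face_subset[OF F] face_subset[OF F'(1)] drawing_mono[OF BE] by blast+
  then obtain x where x: "x \<notin> drawing (border F)" "x \<in> frontier F"
    using connected_Int_frontier[OF con, of F] p \<open>q \<notin> F\<close> by blast
  have "frontier F \<subseteq> drawing E"
    using frontier_of_components_closed_complement[OF compact_imp_closed[OF compact_drawing[OF subset_refl]]] F
    unfolding faces_def by blast
  then have "x \<in> drawing E" "x \<notin> pos ` V" "x \<in> closure F"
    using x by (auto simp: drawing_def frontier_def)
  then obtain e where "e \<in> E" "x \<in> path_image (\<gamma> e)" "x \<notin> pos ` e"
    using edge_subset unfolding drawing_def by blast
  then have "e \<in> border F" using \<open>x \<in> closure F\<close> by (auto simp: border_def)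
  then show False using x(1) \<open>x \<in> path_image (\<gamma> e)\<close> by (auto simp: drawing_def)
qed

text \<open>Adding a bridge never separates the complement, so a separating set of edges contains an edge
  whose ends are joined by earlier ones, and hence a cycle. The hypothesis \<open>girth\<close> expresses in
  terms of edge sets that cycles have length at least \<open>g\<close>.\<close>
lemma card_separating:
  assumes girth: "\<And>M u v. M \<subseteq> E \<Longrightarrow> {u, v} \<in> E - M \<Longrightarrow> joined M u v \<Longrightarrow> g \<le> card M + 1"
    and "M \<subseteq> E" "\<not> connected (- drawing M)"
  shows "g \<le> card M"
  using finite_subset[OF assms(2) finite_E] assms(2,3)
proof (induction M rule: finite_induct)
  case empty
  have "connected (- drawing {})"
    using faces_empty in_components_connected[of "- (pos ` V)" "- (pos ` V)"] by (simp add: faces_def)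
  then show ?case using empty by simp
next
  case (insert e M)
  then have M: "M \<subseteq> E" and e: "e \<in> E" by auto
  obtain u v where uv: "e = {u, v}" using edge[OF e] by blast
  show ?case
  proof (cases "connected (- drawing M)")
    case False
    then show ?thesis using insert by auto
  next
    case True
    have "joined M u v"
    proof (rule ccontr)
      assume "\<not> joined M u v"
      then have "same_face (insert e M) p q" if "p \<notin> drawing (insert e M)" "q \<notin> drawing (insert e M)" for p q
        using same_face_insert_bridge[OF M, of u v p q] e True that unfolding uv
        by (auto simp: drawing_insert connected_iff_connected_component)
      then show False
        using insert.prems by (auto simp: connected_iff_connected_component)
    qed
    then show ?thesis using girth[OF M, of u v] insert e uv by auto
  qed
qed

text \<open>With \<open>f\<close> faces, \<open>n\<close> vertices and \<open>m\<close> edges, double counting gives \<open>6 f \<le> 2 m\<close> if \<open>f \<ge> 2\<close>,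
  and Euler's inequality gives \<open>m + 2 \<le> n + f\<close>. A graph with a single face is a forest, and the
  second inequality alone suffices.\<close>
lemma card_edges_less:
  assumes girth: "\<And>M u v. M \<subseteq> E \<Longrightarrow> {u, v} \<in> E - M \<Longrightarrow> joined M u v \<Longrightarrow> 6 \<le> card M + 1"
    and "V \<noteq> {}"
  shows "2 * card E < 3 * card V"
proof -
  have "clusters E \<noteq> {}" "finite (clusters E)" using assms(2) finite_V by (auto simp: clusters_def)
  then have "card (clusters E) \<ge> 1" by (simp add: Suc_leI card_gt_0_iff)
  then have euler: "card E + 2 \<le> card V + card (faces E)" using euler_inequality[OF subset_refl] by simp
  show ?thesis
  proof (cases "card (faces E) \<ge> 2")
    case True
    have "6 * card (faces E) = (\<Sum>F\<in>faces E. 6)" by simp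
    also have "\<dots> \<le> (\<Sum>F\<in>faces E. card (border F))"
      using card_separating[OF girth] border_separates[OF _ True]
      by (intro sum_mono) (auto simp: border_def)
    also have "\<dots> = (\<Sum>F\<in>faces E. card {e \<in> E. e \<in> border F})"
      by (intro sum.cong refl arg_cong[of _ _ card]) (auto simp: border_def)
    also have "\<dots> = (\<Sum>e\<in>E. card {F \<in> faces E. e \<in> border F})"
      using sum_multicount_gen[OF finite_faces[OF subset_refl] finite_E,
          of "\<lambda>F e. e \<in> border F" "\<lambda>e. card {F \<in> faces E. e \<in> border F}"] by simp
    also have "\<dots> \<le> (\<Sum>e\<in>E. 2)" by (rule sum_mono) (rule card_faces_at_edge)
    also have "\<dots> = 2 * card E" by simp
    finally show ?thesis using euler by linarith
  next
    case False
    moreover have "card V > 0" using assms(2) finite_V by (simp add: card_gt_0_iff)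
    ultimately show ?thesis using euler by linarith
  qed
qed

end

section \<open>Sparsity of planar graphs of girth six\<close>

definition edges :: "'a pair_pre_digraph \<Rightarrow> 'a set set" where
  "edges G = (\<lambda>(u, v). {u, v}) ` parcs G"

lemma edge_iff:
  assumes "pair_graph G"
  shows "{u, v} \<in> edges G \<longleftrightarrow> (u, v) \<in> parcs G"
proof -
  interpret pair_graph G by fact
  have "(v, u) \<in> parcs G \<Longrightarrow> (u, v) \<in> parcs G"
    using pair_sym_arcs by (auto simp: symmetric_def dest: symD)
  then show ?thesis
    unfolding edges_def by (force simp: doubleton_eq_iff)
qed

lemma edge_endpoints:
  assumes "pair_graph G" "e \<in> edges G"
  shows "\<exists>u v. e = {u, v} \<and> (u, v) \<in> parcs G \<and> u \<noteq> v \<and> u \<in> pverts G \<and> v \<in> pverts G"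
proof -
  interpret pair_graph G by fact
  show ?thesis using assms(2) no_loops' in_arcsD1 in_arcsD2 unfolding edges_def by fastforce
qed

lemma finite_pverts: "pair_graph G \<Longrightarrow> finite (pverts G)"
  by (simp add: pair_graph_def pair_digraph_def pair_fin_digraph.pair_finite_verts)

text \<open>The first edge of a path is not repeated, because its tail is not visited again.\<close>
lemma card_path_edges:
  assumes "pair_graph G" "pre_digraph.apath (with_proj G) u p v"
  shows "card ((\<lambda>(x, y). {x, y}) ` set p) = length p"
proof -
  interpret pair_graph G by fact
  from assms(2) show ?thesis
  proof (induction p arbitrary: u)
    case Nil
    then show ?case by simp
  next
    case (Cons a p)
    obtain w where a: "a = (u, w)" using Cons.prems by (cases a) (auto simp: apath_Cons_iff)
    have p: "apath w p v" "u \<notin> set (pawalk_verts w p)" using Cons.prems a by (auto simp: apath_Cons_iff)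
    have "awalk w p v" using p(1) by (rule awalkI_apath)
    then have "x \<in> set (pawalk_verts w p) \<and> y \<in> set (pawalk_verts w p)" if "(x, y) \<in> set p" for x y
      using awalk_verts_arc1[OF that, of w] awalk_verts_arc2[OF _ that] by auto
    then have "{u, w} \<notin> (\<lambda>(x, y). {x, y}) ` set p" using p(2) by (auto simp: doubleton_eq_iff)
    then show ?case using Cons.IH[OF p(1)] by (simp add: a)
  qed
qed

text \<open>The walk that joins the ends of \<open>uv\<close> within \<open>M\<close> can be shortened to a path. It has at least two
  edges, as it avoids \<open>uv\<close> itself, so closing it up gives a cycle of length at least 3.\<close>
lemma girth_le_card:
  assumes G: "pair_graph G" and M: "M \<subseteq> edges G" and uv: "{u, v} \<in> edges G - M" and j: "joined M u v"
  shows "girth G \<le> enat (card M + 1)"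
proof -
  interpret pair_graph G by fact
  have arcs: "(u, v) \<in> parcs G" "(v, u) \<in> parcs G"
    using uv edge_iff[OF G, of u v] edge_iff[OF G, of v u] by (simp_all add: insert_commute)
  then have ne: "u \<noteq> v" using no_loops' by blast
  have "\<exists>p. awalk u p v \<and> (\<forall>(x, y) \<in> set p. {x, y} \<in> M)"
    using j unfolding joined_def
  proof (induction rule: converse_rtrancl_induct)
    case base
    show ?case using arcs in_arcsD2 by (intro exI[of _ "[]"]) (auto simp: awalk_Nil_iff)
  next
    case (step x y)
    then obtain p where p: "awalk y p v" "\<forall>(x, y) \<in> set p. {x, y} \<in> M" by blast
    have "(x, y) \<in> parcs G" using step(1) M edge_iff[OF G, of x y] by auto
    then have "awalk x ((x, y) # p) v" using p(1) by (simp add: awalk_Cons_iff)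
    then show ?case using p(2) step(1) by (intro exI[of _ "(x, y) # p"]) auto
  qed
  then obtain p0 where p0: "awalk u p0 v" "\<forall>(x, y) \<in> set p0. {x, y} \<in> M" by blast
  define p where "p = awalk_to_apath p0"
  have ap: "apath u p v" unfolding p_def by (rule apath_awalk_to_apath[OF p0(1)])
  have pM: "\<forall>(x, y) \<in> set p. {x, y} \<in> M"
    using p0(2) awalk_to_apath_subset[OF p0(1)] unfolding p_def by blast
  have len: "length p \<ge> 2"
  proof (rule ccontr)
    assume "\<not> length p \<ge> 2"
    then consider "p = []" | a where "p = [a]" by (cases p; cases "tl p") auto
    then show False
    proof cases
      case 1
      then show False using ap ne by (simp add: apath_Nil_iff)
    next
      case 2
      then have "a = (u, v)" using ap by (cases a) (simp add: apath_Cons_iff apath_Nil_iff)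
      then show False using 2 pM uv by simp
    qed
  qed
  have aw: "awalk u p v" "distinct (pawalk_verts u p)" using ap by (auto simp: apath_def)
  have "awalk v ((v, u) # p) v" using arcs aw(1) by (simp add: awalk_Cons_iff)
  then have "cycle ((v, u) # p)" unfolding cycle_def using aw(2) by auto
  then have "girth G \<le> enat (length ((v, u) # p))"
    unfolding girth_def using len by (intro INF_lower) auto
  also have "length p \<le> card M"
  proof -
    have "(\<lambda>(x, y). {x, y}) ` set p \<subseteq> M" using pM by auto
    moreover have "finite M"
      using M by (rule finite_subset) (simp add: edges_def pair_finite_arcs)
    ultimately show ?thesis using card_path_edges[OF G ap] card_mono by metis
  qed
  then have "enat (length ((v, u) # p)) \<le> enat (card M + 1)" by simp
  finally show ?thesis .
qed

text \<open>The restriction of a drawing to an induced subgraph is again a drawing: an arc meets no vertex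
  except its ends, so a common vertex of two arcs is an end of both and thus lies in \<open>W\<close>.\<close>
lemma planar_girth_6_sparse:
  assumes G: "pair_graph G" and "planar G" and g: "6 \<le> girth G" and W: "W \<subseteq> pverts G" "W \<noteq> {}"
  shows "2 * card {e \<in> edges G. e \<subseteq> W} < 3 * card W"
proof -
  obtain pos \<gamma> where "plane_drawing G pos \<gamma>" using assms(2) unfolding planar_def by blast
  note d = this[unfolded plane_drawing_def]
  have inj: "inj_on pos (pverts G)" using d by (rule conjunct1)
  have drawn: "arc (\<gamma> {u, v})"
    "{pathstart (\<gamma> {u, v}), pathfinish (\<gamma> {u, v})} = {pos u, pos v}"
    "path_image (\<gamma> {u, v}) \<inter> pos ` pverts G = {pos u, pos v}"
    if "(u, v) \<in> parcs G" for u v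
    using bspec[OF d[THEN conjunct2, THEN conjunct1] that] unfolding prod.case by simp_all
  have cross: "path_image (\<gamma> {u, v}) \<inter> path_image (\<gamma> {x, y}) \<subseteq> pos ` pverts G"
    if uv: "(u, v) \<in> parcs G" and xy: "(x, y) \<in> parcs G" and "{u, v} \<noteq> {x, y}" for u v x y
    using bspec[OF bspec[OF d[THEN conjunct2, THEN conjunct2] uv, unfolded prod.case] xy, unfolded prod.case]
      that(3) by (rule mp)
  let ?E = "{e \<in> edges G. e \<subseteq> W}"
  have edgeE: "\<exists>u v. e = {u, v} \<and> (u, v) \<in> parcs G \<and> u \<noteq> v \<and> u \<in> W \<and> v \<in> W" if "e \<in> ?E" for e
    using that edge_endpoints[OF G, of e] by blast
  have on: "path_image (\<gamma> e) \<inter> pos ` pverts G = pos ` e" if "e \<in> ?E" for e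
    using edgeE[OF that] drawn(3) by force
  interpret plane_graph W ?E pos \<gamma>
  proof
    show "finite W" by (rule finite_subset[OF W(1) finite_pverts[OF G]])
    show "inj_on pos W" using inj W(1) inj_on_subset by blast
  next
    fix e assume e: "e \<in> ?E"
    obtain u v where uv: "e = {u, v}" "(u, v) \<in> parcs G" "u \<noteq> v" "u \<in> W" "v \<in> W"
      using edgeE[OF e] by blast
    show "\<exists>u v. e = {u, v} \<and> u \<noteq> v \<and> u \<in> W \<and> v \<in> W" using uv by blast
    show "arc (\<gamma> e)" using drawn(1)[OF uv(2)] uv(1) by simp
    show "{pathstart (\<gamma> e), pathfinish (\<gamma> e)} = pos ` e" using drawn(2)[OF uv(2)] uv(1) by simp
    show "path_image (\<gamma> e) \<inter> pos ` W = pos ` e" using on[OF e] W(1) e by blast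
  next
    fix e f assume ef: "e \<in> ?E" "f \<in> ?E" "e \<noteq> f"
    obtain u v where uv: "e = {u, v}" "(u, v) \<in> parcs G" using edgeE[OF ef(1)] by blast
    obtain x y where xy: "f = {x, y}" "(x, y) \<in> parcs G" using edgeE[OF ef(2)] by blast
    have "path_image (\<gamma> e) \<inter> path_image (\<gamma> f) \<subseteq> pos ` pverts G"
      using cross[OF uv(2) xy(2)] ef(3) uv(1) xy(1) by simp
    then show "path_image (\<gamma> e) \<inter> path_image (\<gamma> f) \<subseteq> pos ` W" using on[OF ef(1)] ef(1) by blast
  qed
  show ?thesis
  proof (rule card_edges_less)
    fix M u v assume "M \<subseteq> ?E" "{u, v} \<in> ?E - M" "joined M u v"
    then have "6 \<le> enat (card M + 1)"
      using girth_le_card[OF G, of M u v] g order_trans by blast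
    then show "6 \<le> card M + 1" by (simp add: numeral_eq_enat)
  qed (rule W(2))
qed

section \<open>Distances in the inversion graph\<close>

lemma arc_in_inversion:
  assumes "D \<in> orientations G" "(u, v) \<in> parcs G"
  shows "(u, v) \<in> inversion X D \<longleftrightarrow> ((u, v) \<in> D) \<noteq> (u \<in> X \<and> v \<in> X)"
  using assms unfolding orientations_def in_inversion_iff by auto

lemma fold_inversion:
  assumes G: "pair_graph G" and "D \<in> orientations G"
  shows "fold inversion Xs D \<in> orientations G"
    and "(u, v) \<in> parcs G \<Longrightarrow> (u, v) \<in> fold inversion Xs D \<longleftrightarrow>
      ((u, v) \<in> D) \<noteq> odd (length (filter (\<lambda>X. u \<in> X \<and> v \<in> X) Xs))"
  using assms(2)
proof (induction Xs arbitrary: D)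
  case (Cons X Xs)
  { case 1
    then show ?case using Cons(1) inversion_in_orientations[OF G] by simp
  next
    case 2
    then show ?case
      using Cons(2)[of "inversion X D"] inversion_in_orientations[OF G, of D X] arc_in_inversion[of D G u v X]
      by auto }
qed auto

text \<open>The walk may be shorter than the list, because an inversion that changes nothing is not an arc of
  the inversion graph.\<close>
lemma walk_of_inversions:
  assumes G: "pair_graph G" and "D \<in> orientations G" and "\<forall>X\<in>set Xs. X \<subseteq> pverts G"
  shows "\<exists>p. pre_digraph.awalk (with_proj (inversion_graph G)) D p (fold inversion Xs D) \<and>
    length p \<le> length Xs"
proof -
  interpret I: pair_graph "inversion_graph G" by (rule pair_graph_inversion_graph[OF G])
  from assms(2,3) show ?thesis
  proof (induction Xs arbitrary: D)
    case Nil
    then have "D \<in> pverts (inversion_graph G)" by (simp add: inversion_graph_def)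
    then show ?case by (intro exI[of _ "[]"]) (simp add: I.awalk_Nil_iff)
  next
    case (Cons X Xs)
    let ?D = "inversion X D"
    have D: "?D \<in> orientations G" by (rule inversion_in_orientations[OF G Cons.prems(1)])
    then obtain p where p: "I.awalk ?D p (fold inversion Xs ?D)" "length p \<le> length Xs"
      using Cons.IH[of ?D] Cons.prems(2) by auto
    show ?case
    proof (cases "?D = D")
      case True
      then show ?thesis using p by (intro exI[of _ p]) simp
    next
      case False
      then have "(D, ?D) \<in> parcs (inversion_graph G)"
        using Cons.prems D by (auto simp: inversion_graph_def)
      then show ?thesis using p by (intro exI[of _ "(D, ?D) # p"]) (simp add: I.awalk_Cons_iff)
    qed
  qed
qed

lemma graph_dist_inversions:
  assumes G: "pair_graph G" and "D \<in> orientations G" and "\<forall>X\<in>set Xs. X \<subseteq> pverts G"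
  shows "graph_dist (inversion_graph G) D (fold inversion Xs D) \<le> ereal (length Xs)"
proof -
  interpret I: pair_graph "inversion_graph G" by (rule pair_graph_inversion_graph[OF G])
  obtain p where p: "I.awalk D p (fold inversion Xs D)" "length p \<le> length Xs"
    using walk_of_inversions[OF assms] by blast
  have "graph_dist (inversion_graph G) D (fold inversion Xs D) \<le> ereal (I.awalk_cost (\<lambda>_. 1) p)"
    using I.min_cost_le_walk_cost[OF p(1), of "\<lambda>_. 1"] unfolding graph_dist_def .
  also have "I.awalk_cost (\<lambda>_. 1) p = real (length p)" by (induction p) auto
  also have "ereal (length p) \<le> ereal (length Xs)" using p(2) by simp
  finally show ?thesis .
qed

text \<open>Label an edge with 1 if the two orientations differ on it, take vectors with these products, and
  invert for each coordinate the set of vertices whose vector contains it.\<close>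
lemma graph_dist_orientations:
  assumes G: "pair_graph G"
    and sparse: "\<And>W. W \<subseteq> pverts G \<Longrightarrow> W \<noteq> {} \<Longrightarrow> 2 * card {e \<in> edges G. e \<subseteq> W} < 3 * card W"
    and D: "D \<in> orientations G" "D' \<in> orientations G"
  shows "graph_dist (inversion_graph G) D D' \<le> 4"
proof -
  interpret pair_graph G by fact
  define \<pi> where "\<pi> e \<longleftrightarrow> (\<exists>u v. e = {u, v} \<and> (u, v) \<in> D \<and> (u, v) \<notin> D')" for e
  have sub: "D \<subseteq> parcs G" "D' \<subseteq> parcs G" using D by (auto simp: orientations_def)
  have sym: "(v, u) \<in> parcs G" if "(u, v) \<in> parcs G" for u v
    using that edge_iff[OF G, of u v] edge_iff[OF G, of v u] by (simp add: insert_commute)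
  have flip: "(v, u) \<in> D \<longleftrightarrow> (u, v) \<notin> D" "(v, u) \<in> D' \<longleftrightarrow> (u, v) \<notin> D'"
    if "(u, v) \<in> parcs G" for u v
    using D that unfolding orientations_def by auto
  have \<pi>: "\<pi> {u, v} \<longleftrightarrow> ((u, v) \<in> D) \<noteq> ((u, v) \<in> D')" if "(u, v) \<in> parcs G" for u v
    unfolding \<pi>_def using flip[OF that] by (auto simp: doubleton_eq_iff)
  have "\<exists>x :: 'a \<Rightarrow> nat set. (\<forall>v\<in>pverts G. x v \<subseteq> {..<4} \<and> x v \<noteq> {}) \<and>
    (\<forall>u v. {u, v} \<in> edges G \<longrightarrow> odd (card (x u \<inter> x v)) = \<pi> {u, v}) \<and>
    (\<forall>u v. {u, v} \<in> {} \<longrightarrow> x u \<noteq> x v)"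
  proof (rule vectors_with_prescribed_products)
    show "\<forall>e\<in>edges G. e \<subseteq> pverts G \<and> card e = 2"
      using edge_endpoints[OF G] by fastforce
  qed (use sparse pair_finite_verts in auto)
  then obtain x :: "'a \<Rightarrow> nat set" where
    x: "\<forall>v\<in>pverts G. x v \<subseteq> {..<4} \<and> x v \<noteq> {}"
    and xE: "\<forall>u v. {u, v} \<in> edges G \<longrightarrow> odd (card (x u \<inter> x v)) = \<pi> {u, v}"
    by (elim exE conjE)
  define Xs where "Xs = map (\<lambda>i. {w \<in> pverts G. i \<in> x w}) [0..<4]"
  have "fold inversion Xs D = D'"
  proof -
    have F: "fold inversion Xs D \<subseteq> parcs G"
      using fold_inversion(1)[OF G D(1)] by (auto simp: orientations_def)
    have "(u, v) \<in> fold inversion Xs D \<longleftrightarrow> (u, v) \<in> D'" if uv: "(u, v) \<in> parcs G" for u v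
    proof -
      have V: "u \<in> pverts G" "v \<in> pverts G" using uv in_arcsD1 in_arcsD2 by blast+
      have "length (filter (\<lambda>X. u \<in> X \<and> v \<in> X) Xs) = card ({i. i \<in> x u \<and> i \<in> x v} \<inter> {0..<4})"
        unfolding Xs_def filter_map length_map
        using V by (subst distinct_length_filter) (simp_all add: comp_def)
      also have "{i. i \<in> x u \<and> i \<in> x v} \<inter> {0..<4} = x u \<inter> x v" using x V by fastforce
      finally have "odd (length (filter (\<lambda>X. u \<in> X \<and> v \<in> X) Xs)) = \<pi> {u, v}"
        using xE[rule_format, of u v] edge_iff[OF G, of u v] uv by simp
      then show ?thesis using fold_inversion(2)[OF G D(1) uv, of Xs] \<pi>[OF uv] by auto
    qed
    then show ?thesis using F sub(2) by auto
  qed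
  moreover have "graph_dist (inversion_graph G) D (fold inversion Xs D) \<le> ereal (length Xs)"
    by (rule graph_dist_inversions[OF G D(1)]) (auto simp: Xs_def)
  ultimately show ?thesis by (simp add: Xs_def)
qed

theorem theorem1p5:
  fixes G :: "'a pair_pre_digraph"
  assumes "pair_graph G"
    and "planar G"
    and "6 \<le> girth G"
  shows "graph_diameter (inversion_graph G) \<le> 4"
  unfolding graph_diameter_def
proof (intro SUP_least)
  fix D D' assume "D \<in> pverts (inversion_graph G)" "D' \<in> pverts (inversion_graph G)"
  then show "graph_dist (inversion_graph G) D D' \<le> 4"
    using planar_girth_6_sparse[OF assms] graph_dist_orientations[OF assms(1)]
    by (simp add: inversion_graph_def)
qed

end
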